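(* Let $g\colon\mathbb{R}^{2}\to\mathbb{R}$. (i) If $g=\mathsf{Q}[f]$ for some function $f\colon\mathbb{R}\to\mathbb{R}$, then $g$ satisfies $$g(x+y,z)+g(x-y,z)+2g(x,y)=g(x,y+z)+g(x,y-z)+2g(y,z)\qquad\text{for all }x,y,z\in\mathbb{R}.\tag{C}$$ (ii) Conversely, if $g\in C^{2}(\mathbb{R}^{2})$ satisfies (C), then the function $f\colon\mathbb{R}\to\mathbb{R}$ defined by $$f(x)=-\tfrac12\,g(0,0)-\tfrac12\,(\partial_{2}g)(0,0)\,x+\tfrac12\int_{0}^{x}(x-t)\,(\partial_{2}^{2}g)(t,0)\,\mathrm{d}t$$ belongs to $C^{2}(\mathbb{R})$ and satisfies $\mathsf{Q}[f]=g$ on $\mathbb{R}^{2}$. Moreover, the solution is unique up to addition of an element of $\ker\mathsf{Q}$: if $f_1,f_2\colon\mathbb{R}\to\mathbb{R}$ satisfy $\mathsf{Q}[f_1]=\mathsf{Q}[f_2]=g$, then $f_1-f_2\in\ker\mathsf{Q}$.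
   Context: For a function $f\colon\mathbb{R}\to\mathbb{R}$, the function $\mathsf{Q}[f]\colon\mathbb{R}^{2}\to\mathbb{R}$ is defined by $$\mathsf{Q}[f](x,y)=f(x+y)+f(x-y)-2f(x)-2f(y),\qquad (x,y)\in\mathbb{R}^2.$$ The operator $\mathsf{Q}$ is linear, and $\ker\mathsf{Q}$ is the set of all functions $f\colon\mathbb{R}\to\mathbb{R}$ with $\mathsf{Q}[f]\equiv 0$. The symbols $\partial_1$ and $\partial_2$ denote partial differentiation with respect to the first and second variable, respectively. *)

theory Defs
  imports "HOL-Analysis.Analysis"
begin

definition Qop :: "(real \<Rightarrow> real) \<Rightarrow> real \<times> real \<Rightarrow> real" where
  "Qop f = (\<lambda>(x, y). f (x + y) + f (x - y) - 2 * f x - 2 * f y)"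

definition ker_Q :: "(real \<Rightarrow> real) set" where
  "ker_Q = {f. \<forall>p. Qop f p = 0}"

definition partial1 :: "(real \<times> real \<Rightarrow> real) \<Rightarrow> real \<times> real \<Rightarrow> real" where
  "partial1 g = (\<lambda>(x, y). deriv (\<lambda>s. g (s, y)) x)"

definition partial2 :: "(real \<times> real \<Rightarrow> real) \<Rightarrow> real \<times> real \<Rightarrow> real" where
  "partial2 g = (\<lambda>(x, y). deriv (\<lambda>t. g (x, t)) y)"

text \<open>Since \<^const>\<open>deriv\<close> is total, the existence of the partial derivatives has to be
  required separately.\<close>

definition has_partials :: "(real \<times> real \<Rightarrow> real) \<Rightarrow> bool" where
  "has_partials g \<longleftrightarrow>
     (\<forall>x y. (\<lambda>s. g (s, y)) differentiable (at x) \<and> (\<lambda>t. g (x, t)) differentiable (at y))"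

text \<open>\<open>Ck_plane k g\<close> is the class \<open>C\<^sup>k(\<real>\<^sup>2)\<close>: all iterated partial derivatives
  of \<open>g\<close> of order at most \<open>k\<close>, in any order of differentiation, exist and are continuous on the plane.
  Likewise \<open>Ck_line k f\<close> is the class \<open>C\<^sup>k(\<real>)\<close>.\<close>

primrec Ck_plane :: "nat \<Rightarrow> (real \<times> real \<Rightarrow> real) \<Rightarrow> bool" where
  "Ck_plane 0 g \<longleftrightarrow> continuous_on UNIV g"
| "Ck_plane (Suc k) g \<longleftrightarrow>
     continuous_on UNIV g \<and> has_partials g \<and> Ck_plane k (partial1 g) \<and> Ck_plane k (partial2 g)"

primrec Ck_line :: "nat \<Rightarrow> (real \<Rightarrow> real) \<Rightarrow> bool" where
  "Ck_line 0 f \<longleftrightarrow> continuous_on UNIV f"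
| "Ck_line (Suc k) f \<longleftrightarrow>
     continuous_on UNIV f \<and> (\<forall>x. f differentiable (at x)) \<and> Ck_line k (deriv f)"

definition condition_C :: "(real \<times> real \<Rightarrow> real) \<Rightarrow> bool" where
  "condition_C g \<longleftrightarrow>
     (\<forall>x y z. g (x + y, z) + g (x - y, z) + 2 * g (x, y)
            = g (x, y + z) + g (x, y - z) + 2 * g (y, z))"

end

theory Submission imports Defs begin

text \<open>For (ii), differentiating (C) twice in \<open>z\<close> at \<open>z = 0\<close> expresses \<open>\<partial>\<^sub>2\<^sup>2 g (x, y)\<close> through the
  function \<open>\<partial>\<^sub>2\<^sup>2 g (\<cdot>, 0) = 2 f''\<close>, and the result is exactly \<open>\<partial>\<^sub>2\<^sup>2 (Q f) (x, y)\<close>. Hence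
  \<open>g - Q f\<close> is affine in its second argument. Putting \<open>y = z = 0\<close> in (C) and in its first
  \<open>z\<close>-derivative shows that \<open>g (x, 0)\<close> and \<open>\<partial>\<^sub>2 g (x, 0)\<close> do not depend on \<open>x\<close>, and the two
  constants in \<open>f\<close> are chosen such that these initial values agree with those of \<open>Q f\<close>.\<close>

lemma Qop_apply: "Qop f (x, y) = f (x + y) + f (x - y) - 2 * f x - 2 * f y"
  by (simp add: Qop_def)

lemma condition_C_Qop: "condition_C (Qop f)"
  unfolding condition_C_def Qop_apply by (simp add: algebra_simps)

lemma Qop_diff: "Qop (\<lambda>x. f x - g x) p = Qop f p - Qop g p"
  by (cases p) (simp add: Qop_apply)

text \<open>Taking the whole extended line as the interval yields a single antiderivative on all of
  the reals, so no case distinction on the sign of \<open>x\<close> arises.\<close>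

lemma continuous_has_antiderivative:
  fixes k :: "real \<Rightarrow> real"
  assumes "continuous_on UNIV k"
  obtains K where "\<And>x. (K has_real_derivative k x) (at x)"
proof -
  have "\<exists>K. \<forall>x. -\<infinity> < ereal x \<longrightarrow> ereal x < \<infinity> \<longrightarrow> (K has_vector_derivative k x) (at x)"
    using assms by (intro einterval_antiderivative) (auto simp: continuous_on_eq_continuous_at)
  then show thesis
    using that by (auto simp: has_real_derivative_iff_has_vector_derivative)
qed

text \<open>Here \<open>x\<close> occurs both as a limit and in the integrand. The closed form
  removes the integral, so that differentiating in \<open>x\<close> is elementary.\<close>

lemma interval_integral_Cauchy_repeated:
  fixes k K L :: "real \<Rightarrow> real"
  assumes cont: "continuous_on UNIV k"
    and K: "\<And>x. (K has_real_derivative k x) (at x)"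
    and L: "\<And>x. (L has_real_derivative K x) (at x)"
  shows "(LBINT t=ereal 0..ereal x. (x - t) * k t) = L x - L 0 - x * K 0"
proof -
  \<comment> \<open>By the product rule the summand \<open>L t\<close> cancels the term
    \<open>- K t\<close> that comes from differentiating \<open>x - t\<close>.\<close>
  define F where "F = (\<lambda>t. (x - t) * K t + L t)"
  have "(F has_real_derivative (x - t) * k t) (at t)" for t
    unfolding F_def by (auto intro!: derivative_eq_intros K L)
  then have F: "(F has_vector_derivative (x - t) * k t) (at t within S)" for t S
    by (metis has_real_derivative_iff_has_vector_derivative has_vector_derivative_at_within)
  have "(LBINT t=ereal 0..ereal x. (x - t) * k t) = F x - F 0"
    by (intro interval_integral_FTC_finite F)
      (auto intro!: continuous_intros continuous_on_subset[OF cont])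
  then show ?thesis
    by (simp add: F_def)
qed

text \<open>The difference of the first derivatives has derivative 0 and vanishes at
  \<open>a\<close>, hence everywhere; the same argument then applies to
  \<open>p - q\<close>.\<close>

lemma eq_of_second_derivatives_eq:
  fixes p q :: "real \<Rightarrow> real"
  assumes "\<And>y. (p has_real_derivative p' y) (at y)" "\<And>y. (p' has_real_derivative r y) (at y)"
    and "\<And>y. (q has_real_derivative q' y) (at y)" "\<And>y. (q' has_real_derivative r y) (at y)"
    and "p a = q a" "p' a = q' a"
  shows "p = q"
proof
  fix y
  have "((\<lambda>y. p' y - q' y) has_real_derivative 0) (at y)" for y
    by (auto intro!: derivative_eq_intros assms)
  then have "p' y - q' y = p' a - q' a" for y
    by (rule DERIV_isconst_all[rule_format, rotated])
  then have "((\<lambda>y. p y - q y) has_real_derivative 0) (at y)" for y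
    using \<open>p' a = q' a\<close> by (auto intro!: derivative_eq_intros assms)
  then have "p y - q y = p a - q a"
    by (rule DERIV_isconst_all[rule_format, rotated])
  then show "p y = q y"
    using \<open>p a = q a\<close> by simp
qed

lemma has_partials_partial2:
  "has_partials g \<Longrightarrow> ((\<lambda>t. g (x, t)) has_real_derivative partial2 g (x, y)) (at y)"
  unfolding has_partials_def partial2_def
  by (auto simp: DERIV_deriv_iff_real_differentiable)

lemma Ck_line_2I:
  assumes "\<And>x. (f has_real_derivative f' x) (at x)" "\<And>x. (f' has_real_derivative f'' x) (at x)"
    and "continuous_on UNIV f''"
  shows "Ck_line 2 f"
proof -
  have "deriv f = f'" "deriv f' = f''"
    using assms by (auto intro: DERIV_imp_deriv)
  then show ?thesis
    using assms by (auto simp: numeral_2_eq_2 real_differentiable_def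
        continuous_on_eq_continuous_at intro: DERIV_isCont)
qed

context
  fixes g g2 g22 :: "real \<times> real \<Rightarrow> real"
  assumes C: "condition_C g"
    and g2: "\<And>x y. ((\<lambda>t. g (x, t)) has_real_derivative g2 (x, y)) (at y)"
    and g22: "\<And>x y. ((\<lambda>t. g2 (x, t)) has_real_derivative g22 (x, y)) (at y)"
begin

text \<open>This is the \<open>z\<close>-derivative of (C): the term \<open>2 * g (x, y)\<close> is
  constant in \<open>z\<close>, and the inner derivative of \<open>y - z\<close> gives the minus
  sign.\<close>

lemma condition_C_partial2:
  "g2 (x + y, z) + g2 (x - y, z) = g2 (x, y + z) - g2 (x, y - z) + 2 * g2 (y, z)"
proof (rule DERIV_unique)
  let ?l = "\<lambda>z. g (x + y, z) + g (x - y, z) + 2 * g (x, y)"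
  show "(?l has_real_derivative g2 (x + y, z) + g2 (x - y, z)) (at z)"
    by (auto intro!: derivative_eq_intros g2)
  let ?r = "\<lambda>z. g (x, y + z) + g (x, y - z) + 2 * g (y, z)"
  have "?l = ?r"
    using C by (simp add: condition_C_def)
  moreover have "(?r has_real_derivative g2 (x, y + z) - g2 (x, y - z) + 2 * g2 (y, z)) (at z)"
    by (auto intro!: derivative_eq_intros g2 DERIV_chain2[OF g2])
  ultimately show "(?l has_real_derivative g2 (x, y + z) - g2 (x, y - z) + 2 * g2 (y, z)) (at z)"
    by simp
qed

lemma condition_C_partial22:
  "g22 (x + y, z) + g22 (x - y, z) = g22 (x, y + z) + g22 (x, y - z) + 2 * g22 (y, z)"
proof (rule DERIV_unique)
  let ?l = "\<lambda>z. g2 (x + y, z) + g2 (x - y, z)"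
  show "(?l has_real_derivative g22 (x + y, z) + g22 (x - y, z)) (at z)"
    by (auto intro!: derivative_eq_intros g22)
  let ?r = "\<lambda>z. g2 (x, y + z) - g2 (x, y - z) + 2 * g2 (y, z)"
  have "?l = ?r"
    by (simp add: condition_C_partial2)
  moreover have "(?r has_real_derivative g22 (x, y + z) + g22 (x, y - z) + 2 * g22 (y, z)) (at z)"
    by (auto intro!: derivative_eq_intros g22 DERIV_chain2[OF g22])
  ultimately show "(?l has_real_derivative g22 (x, y + z) + g22 (x, y - z) + 2 * g22 (y, z)) (at z)"
    by simp
qed

text \<open>For each fixed \<open>x\<close>, both sides solve the same second-order initial value
  problem in \<open>y\<close>, with data at \<open>y = 0\<close>.\<close>

lemma Qop_eq_of_second_derivative:
  assumes f: "\<And>x. (f has_real_derivative f' x) (at x)"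
    and f': "\<And>x. (f' has_real_derivative g22 (x, 0) / 2) (at x)"
    and "f 0 = - g (0, 0) / 2" "f' 0 = - g2 (0, 0) / 2"
  shows "Qop f = g"
proof -
  have "(\<lambda>y. Qop f (x, y)) = (\<lambda>y. g (x, y))" for x
  proof (rule eq_of_second_derivatives_eq[where a = 0])
    show "((\<lambda>y. Qop f (x, y)) has_real_derivative f' (x + y) - f' (x - y) - 2 * f' y) (at y)" for y
      unfolding Qop_apply by (auto intro!: derivative_eq_intros f DERIV_chain2[OF f])
    \<comment> \<open>At \<open>z = 0\<close> the two terms \<open>g22 (x, y + z)\<close> and
      \<open>g22 (x, y - z)\<close> merge, so the identity can be solved for
      \<open>g22 (x, y)\<close>.\<close>
    have "g22 (x, y) = g22 (x + y, 0) / 2 + g22 (x - y, 0) / 2 - g22 (y, 0)" for y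
      using condition_C_partial22[of x y 0] by simp
    then show "((\<lambda>y. f' (x + y) - f' (x - y) - 2 * f' y) has_real_derivative g22 (x, y)) (at y)" for y
      by (auto intro!: derivative_eq_intros f' DERIV_chain2[OF f'])
    have "g (x, 0) = g (0, 0)"
      using C[unfolded condition_C_def, rule_format, of x 0 0] by simp
    \<comment> \<open>The left side collapses to \<open>- 2 * f 0\<close>, which explains the
      prescribed value of \<open>f 0\<close>; likewise \<open>- 2 * f' 0\<close> below.\<close>
    then show "Qop f (x, 0) = g (x, 0)"
      using assms by (simp add: Qop_apply)
    have "g2 (x, 0) = g2 (0, 0)"
      using condition_C_partial2[of x 0 0] by simp
    then show "f' (x + 0) - f' (x - 0) - 2 * f' 0 = g2 (x, 0)"
      using assms by simp
  qed (rule g2 g22)+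
  then show ?thesis
    by (auto simp: fun_eq_iff)
qed

end

theorem theorem1p1:
  fixes g :: "real \<times> real \<Rightarrow> real"
  shows "((\<exists>f. g = Qop f) \<longrightarrow> condition_C g)
    \<and> (Ck_plane 2 g \<and> condition_C g \<longrightarrow>
        (let f = (\<lambda>x::real. - (1/2) * g (0, 0) - (1/2) * partial2 g (0, 0) * x
                   + (1/2) * (LBINT t=ereal 0..ereal x. (x - t) * partial2 (partial2 g) (t, 0)))
         in Ck_line 2 f \<and> Qop f = g))
    \<and> (\<forall>f1 f2. Qop f1 = g \<and> Qop f2 = g \<longrightarrow> (\<lambda>x. f1 x - f2 x) \<in> ker_Q)"
proof (intro conjI impI allI)
  show "condition_C g" if "\<exists>f. g = Qop f"
    using that condition_C_Qop by auto
  show "(\<lambda>x. f1 x - f2 x) \<in> ker_Q" if "Qop f1 = g \<and> Qop f2 = g" for f1 f2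
    using that by (simp add: ker_Q_def Qop_diff)
  assume asm: "Ck_plane 2 g \<and> condition_C g"
  define k where "k = (\<lambda>t. partial2 (partial2 g) (t, 0))"
  have partials: "has_partials g" "has_partials (partial2 g)"
    and cont: "continuous_on UNIV (partial2 (partial2 g))"
    using asm by (auto simp: numeral_2_eq_2)
  have k: "continuous_on UNIV k"
    unfolding k_def by (rule continuous_on_compose2[OF cont]) (auto intro!: continuous_intros)
  obtain K where K: "\<And>x. (K has_real_derivative k x) (at x)"
    using continuous_has_antiderivative[OF k] by blast
  then have "continuous_on UNIV K"
    by (auto simp: continuous_on_eq_continuous_at intro: DERIV_isCont)
  then obtain L where L: "\<And>x. (L has_real_derivative K x) (at x)"
    using continuous_has_antiderivative by blast
  \<comment> \<open>This is the function of the theorem with its integral already evaluated.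
    Subtracting \<open>L 0\<close> and \<open>x * K 0\<close> makes the last bracket and its
    derivative vanish at 0, whichever antiderivatives were obtained.\<close>
  define f where "f = (\<lambda>x. - (1/2) * g (0, 0) - (1/2) * partial2 g (0, 0) * x
                          + (1/2) * (L x - L 0 - x * K 0))"
  define f' where "f' = (\<lambda>x. - (1/2) * partial2 g (0, 0) + (1/2) * (K x - K 0))"
  have f: "(f has_real_derivative f' x) (at x)" for x
    unfolding f_def f'_def by (auto intro!: derivative_eq_intros L)
  have f': "(f' has_real_derivative k x / 2) (at x)" for x
    unfolding f'_def by (auto intro!: derivative_eq_intros K)
  have "Ck_line 2 f"
    using f f' by (rule Ck_line_2I) (intro continuous_intros k, simp)
  moreover have "Qop f = g"
  proof (rule Qop_eq_of_second_derivative)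
    show "condition_C g"
      using asm ..
    show "(f' has_real_derivative partial2 (partial2 g) (x, 0) / 2) (at x)" for x
      using f' by (simp add: k_def)
    show "f 0 = - g (0, 0) / 2" "f' 0 = - partial2 g (0, 0) / 2"
      by (simp_all add: f_def f'_def)
  qed (intro has_partials_partial2 partials f)+
  moreover have "(LBINT t=ereal 0..ereal x. (x - t) * partial2 (partial2 g) (t, 0))
      = L x - L 0 - x * K 0" for x
    using interval_integral_Cauchy_repeated[OF k K L] by (simp add: k_def)
  ultimately show "let f = (\<lambda>x::real. - (1/2) * g (0, 0) - (1/2) * partial2 g (0, 0) * x
                   + (1/2) * (LBINT t=ereal 0..ereal x. (x - t) * partial2 (partial2 g) (t, 0)))
         in Ck_line 2 f \<and> Qop f = g"
    by (simp add: f_def)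
qed

end
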